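(* Let $n$ be a positive integer. For any subset $\mathcal{A}\subseteq\mathcal{A}_n$, the ring $\mathcal{S}_{\mathcal{A}}$ is the integral closure of $\mathcal{R}_{\mathcal{A}}$ (in its quotient field $\mathbb{Q}(X)$).
   Context: $\mathcal{A}_n$ denotes the set of all algebraic integers of degree less than or equal to $n$ over $\mathbb{Q}$ in a fixed algebraic closure $\overline{\mathbb{Q}}$. For an algebraic integer $\alpha$, let $O_{\mathbb{Q}(\alpha)}$ be the ring of integers of $\mathbb{Q}(\alpha)$, and set $R_\alpha=\{f\in\mathbb{Q}[X]\mid f(\alpha)\in\mathbb{Z}[\alpha]\}$ and $S_\alpha=\{f\in\mathbb{Q}[X]\mid f(\alpha)\in O_{\mathbb{Q}(\alpha)}\}$. For $\mathcal{A}\subseteq\mathcal{A}_n$ set $\mathcal{R}_{\mathcal{A}}=\bigcap_{\alpha\in\mathcal{A}}R_\alpha$ and $\mathcal{S}_{\mathcal{A}}=\bigcap_{\alpha\in\mathcal{A}}S_\alpha$ (intersections taken inside $\mathbb{Q}[X]$). *)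

theory Defs
  imports
    "HOL-Computational_Algebra.Computational_Algebra"
    "HOL-Algebra.Algebraic_Closure_Type"
begin

hide_const (open) Polynomials.lead_coeff Polynomials.degree Divisibility.irreducible
  up_ring.coeff up_ring.monom

text \<open>
  The fixed algebraic closure of the rationals; the rationals are embedded by \<^const>\<open>of_rat\<close>,
  which agrees with \<^const>\<open>to_ac\<close> (lemma \<open>of_rat_eq_to_ac\<close>).
\<close>

type_synonym qbar = "rat alg_closure"

lemma of_rat_eq_to_ac: "(of_rat q :: qbar) = to_ac q"
proof (cases q)
  case (Fract a b)
  have "to_ac q = to_ac (of_int a / of_int b)"
    using Fract by (simp add: Fract_of_int_quotient)
  also have "\<dots> = of_rat q"
    using Fract by (simp add: of_rat_rat)
  finally show ?thesis ..
qed

definition eval_rat :: "rat poly \<Rightarrow> qbar \<Rightarrow> qbar" where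
  "eval_rat f \<alpha> = poly (map_poly of_rat f) \<alpha>"

definition is_min_poly :: "rat poly \<Rightarrow> qbar \<Rightarrow> bool" where
  "is_min_poly p \<alpha> \<longleftrightarrow> lead_coeff p = 1 \<and> irreducible p \<and> eval_rat p \<alpha> = 0"

definition min_poly :: "qbar \<Rightarrow> rat poly" where
  "min_poly \<alpha> = (THE p. is_min_poly p \<alpha>)"

definition alg_degree :: "qbar \<Rightarrow> nat" where
  "alg_degree \<alpha> = degree (min_poly \<alpha>)"

definition alg_ints_upto :: "nat \<Rightarrow> qbar set" where
  "alg_ints_upto n = {\<alpha>. algebraic_int \<alpha> \<and> alg_degree \<alpha> \<le> n}"

definition int_adjoin :: "qbar \<Rightarrow> qbar set" where
  "int_adjoin \<alpha> = range (\<lambda>p :: int poly. poly (map_poly of_int p) \<alpha>)"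

definition rat_adjoin :: "qbar \<Rightarrow> qbar set" where
  "rat_adjoin \<alpha> = {eval_rat p \<alpha> / eval_rat q \<alpha> | p q. eval_rat q \<alpha> \<noteq> 0}"

definition ring_of_integers :: "qbar set \<Rightarrow> qbar set" where
  "ring_of_integers K = {x \<in> K. algebraic_int x}"

definition R_elem :: "qbar \<Rightarrow> rat poly set" where
  "R_elem \<alpha> = {f. eval_rat f \<alpha> \<in> int_adjoin \<alpha>}"

definition S_elem :: "qbar \<Rightarrow> rat poly set" where
  "S_elem \<alpha> = {f. eval_rat f \<alpha> \<in> ring_of_integers (rat_adjoin \<alpha>)}"

text \<open>For the empty set both intersections are all of \<open>\<rat>[X]\<close>.\<close>

definition R_set :: "qbar set \<Rightarrow> rat poly set" where
  "R_set A = (\<Inter>\<alpha>\<in>A. R_elem \<alpha>)"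

definition S_set :: "qbar set \<Rightarrow> rat poly set" where
  "S_set A = (\<Inter>\<alpha>\<in>A. S_elem \<alpha>)"

text \<open>
  The following two notions are meant for a subring \<open>R\<close> of a field, given by its carrier set.
  The field \<open>\<rat>(X)\<close> is the type \<^typ>\<open>rat poly fract\<close>, into which
  \<open>\<rat>[X]\<close> is embedded by \<^const>\<open>to_fract\<close>.
\<close>

definition quotient_field :: "'a :: field set \<Rightarrow> 'a set" where
  "quotient_field R = {a / b | a b. a \<in> R \<and> b \<in> R \<and> b \<noteq> 0}"

definition integral_closure :: "'a :: field set \<Rightarrow> 'a set \<Rightarrow> 'a set" where
  "integral_closure R K =
     {x \<in> K. \<exists>p. lead_coeff p = 1 \<and> (\<forall>i. coeff p i \<in> R) \<and> poly p x = 0}"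

lemma eval_rat_simps [simp]:
  "eval_rat 0 \<alpha> = 0" "eval_rat 1 \<alpha> = 1"
  "eval_rat (p + q) \<alpha> = eval_rat p \<alpha> + eval_rat q \<alpha>"
  "eval_rat (p - q) \<alpha> = eval_rat p \<alpha> - eval_rat q \<alpha>"
  "eval_rat (p * q) \<alpha> = eval_rat p \<alpha> * eval_rat q \<alpha>"
  "eval_rat (smult c p) \<alpha> = of_rat c * eval_rat p \<alpha>"
  "eval_rat [:c:] \<alpha> = of_rat c"
proof -
  have add: "map_poly (of_rat :: rat \<Rightarrow> qbar) (p + q) = map_poly of_rat p + map_poly of_rat q"
    for p q by (rule poly_eqI) (simp add: coeff_map_poly of_rat_add)
  have diff: "map_poly (of_rat :: rat \<Rightarrow> qbar) (p - q) = map_poly of_rat p - map_poly of_rat q"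
    for p q by (rule poly_eqI) (simp add: coeff_map_poly of_rat_diff)
  have mult: "map_poly (of_rat :: rat \<Rightarrow> qbar) (p * q) = map_poly of_rat p * map_poly of_rat q"
    for p q by (rule poly_eqI) (simp add: coeff_map_poly coeff_mult of_rat_sum of_rat_mult)
  have smult: "map_poly (of_rat :: rat \<Rightarrow> qbar) (smult c p) = smult (of_rat c) (map_poly of_rat p)"
    for c p by (rule poly_eqI) (simp add: coeff_map_poly of_rat_mult)
  show "eval_rat 0 \<alpha> = 0" "eval_rat 1 \<alpha> = 1"
    "eval_rat (p + q) \<alpha> = eval_rat p \<alpha> + eval_rat q \<alpha>"
    "eval_rat (p - q) \<alpha> = eval_rat p \<alpha> - eval_rat q \<alpha>"
    "eval_rat (p * q) \<alpha> = eval_rat p \<alpha> * eval_rat q \<alpha>"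
    "eval_rat (smult c p) \<alpha> = of_rat c * eval_rat p \<alpha>"
    "eval_rat [:c:] \<alpha> = of_rat c"
    unfolding eval_rat_def add diff mult smult by (simp_all add: map_poly_pCons)
qed

text \<open>
  The minimal polynomial is well defined, since every element of the algebraic closure is algebraic.
\<close>

lemma ex1_min_poly: "\<exists>!p. is_min_poly p \<alpha>"
proof -
  define P where "P = (\<lambda>p. p \<noteq> 0 \<and> eval_rat p \<alpha> = 0)"
  have "(to_ac :: rat \<Rightarrow> qbar) = of_rat"
    by (rule ext) (simp add: of_rat_eq_to_ac)
  then have "\<exists>p. P p"
    using alg_closure_algebraic[of \<alpha>] unfolding P_def eval_rat_def by metis
  then obtain m0 where m0: "P m0" and least0: "\<And>p. P p \<Longrightarrow> degree m0 \<le> degree p"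
    using ex_has_least_nat[of P _ degree] by metis
  define m where "m = smult (inverse (lead_coeff m0)) m0"
  have m: "P m" "lead_coeff m = 1" "degree m = degree m0"
    using m0 by (auto simp: m_def P_def)
  have least: "degree m \<le> degree p" if "P p" for p
    using least0[OF that] m(3) by simp
  have const: "is_unit p" if "p \<noteq> 0" "degree p = 0" for p :: "rat poly"
    using that by (simp add: is_unit_iff_degree)
  have nonunit: "\<not> is_unit p" if p: "P p" for p
  proof
    assume "is_unit p"
    then obtain c where c: "p = [:c:]"
      by (auto simp: is_unit_poly_iff)
    then show False
      using p by (simp add: P_def)
  qed
  have "irreducible m"
  proof (rule irreducibleI)
    show "m \<noteq> 0" using m(1) by (simp add: P_def)
    show "\<not> is_unit m" by (rule nonunit[OF m(1)])
    fix a b assume ab: "m = a * b"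
    then have nz: "a \<noteq> 0" "b \<noteq> 0" using m(1) by (auto simp: P_def)
    have deg: "degree m = degree a + degree b"
      using ab nz by (simp add: degree_mult_eq)
    have "P a \<or> P b"
      using m(1) nz ab by (auto simp: P_def)
    then have "degree a = 0 \<or> degree b = 0"
      using least[of a] least[of b] deg by auto
    then show "is_unit a \<or> is_unit b"
      using nz const by auto
  qed
  moreover have "p = m" if p: "is_min_poly p \<alpha>" for p
  proof -
    have irr: "irreducible p" and pe: "eval_rat p \<alpha> = 0" and lc: "lead_coeff p = 1"
      using p by (auto simp: is_min_poly_def)
    have "p mod m = p - m * (p div m)"
      by (simp add: minus_mult_div_eq_mod)
    then have "eval_rat (p mod m) \<alpha> = 0"
      using pe m(1) by (simp add: P_def)
    then have "p mod m = 0"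
      using least[of "p mod m"] degree_mod_less[of m p] m(1) by (force simp: P_def)
    then obtain k where k: "p = m * k" by (auto elim: dvdE simp: mod_eq_0_iff_dvd)
    then have "is_unit k"
      using irreducibleD[OF irr k] nonunit[OF m(1)] by auto
    then obtain c where c: "k = [:c:]" by (auto simp: is_unit_poly_iff)
    have "lead_coeff p = c"
      using m(2) by (simp add: k c lead_coeff_mult)
    with lc k c show ?thesis by simp
  qed
  ultimately show ?thesis
    using m unfolding is_min_poly_def P_def by blast
qed

lemma min_poly: "is_min_poly (min_poly \<alpha>) \<alpha>"
  unfolding min_poly_def by (rule theI'[OF ex1_min_poly])

end

theory Submission
  imports Defs "Jordan_Normal_Form.Char_Poly"
begin

text \<open>
  A fraction integral over \<open>\<R>\<^sub>A\<close> is a polynomial \<open>f\<close>, since \<open>\<rat>[X]\<close> is integrally closed, and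
  evaluating its integral equation at \<open>\<alpha> \<in> A\<close> shows that \<open>f(\<alpha>)\<close> is integral over \<open>\<int>[\<alpha>]\<close>.
  Conversely, let \<open>f \<in> \<S>\<^sub>A\<close> with \<open>d f \<in> \<int>[X]\<close>. Every \<open>\<beta> = f(\<alpha>)\<close> is a root of a monic integer
  polynomial \<open>m\<close> of degree exactly \<open>n\<close>. Let \<open>P\<close> be the product of representatives modulo
  \<open>d\<^sup>n\<^sup>-\<^sup>1\<close> of all monic polynomials of degree \<open>n\<close>; there are only finitely many of them, and one is
  congruent to \<open>m\<close>. Reducing modulo \<open>m\<close> gives \<open>\<beta> P(\<beta>) = d\<^sup>n\<^sup>-\<^sup>1 t(\<beta>)\<close> with \<open>deg t < n\<close>, which lies
  in \<open>\<int>[\<alpha>]\<close> because \<open>d \<beta>\<close> does. Hence \<open>w = - f P(f)\<close> is in \<open>\<R>\<^sub>A\<close>, and \<open>f\<close> is a root of the monic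
  polynomial \<open>Y P(Y) + w\<close>.
\<close>

section \<open>Linear algebra and division for monic polynomials\<close>

text \<open>
  The vector of the \<open>e i\<close> is an eigenvector for \<open>\<beta>\<close> of a matrix over \<open>'r\<close>; the
  characteristic polynomial of that matrix is the witness.
\<close>

lemma monic_annihilator:
  fixes hom :: "'r :: comm_ring_1 \<Rightarrow> 'a :: field" and e :: "'i \<Rightarrow> 'a"
  assumes hom: "comm_ring_hom hom" and I: "finite I" "k \<in> I" "e k \<noteq> 0"
    and stable: "\<And>i. i \<in> I \<Longrightarrow> \<exists>c. \<beta> * e i = (\<Sum>j\<in>I. hom (c j) * e j)"
  shows "\<exists>p. degree p = card I \<and> lead_coeff p = 1 \<and> poly (map_poly hom p) \<beta> = 0"
proof -
  interpret comm_ring_hom hom by (rule hom)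
  let ?N = "card I"
  obtain g where g: "bij_betw g {0..<?N} I"
    using ex_bij_betw_nat_finite[OF I(1)] by blast
  have "\<forall>i\<in>I. \<exists>c. \<beta> * e i = (\<Sum>j\<in>I. hom (c j) * e j)"
    using stable by blast
  then obtain c where c: "\<forall>i\<in>I. \<beta> * e i = (\<Sum>j\<in>I. hom (c i j) * e j)"
    by metis
  define A where "A = mat ?N ?N (\<lambda>(i, j). c (g i) (g j))"
  define v where "v = vec ?N (\<lambda>i. e (g i))"
  have A: "A \<in> carrier_mat ?N ?N" and v: "v \<in> carrier_vec ?N"
    by (auto simp: A_def v_def)
  have gI: "g i \<in> I" if "i < ?N" for i
    using g that by (auto simp: bij_betw_def)
  have "map_mat hom A *\<^sub>v v = \<beta> \<cdot>\<^sub>v v"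
  proof (rule eq_vecI)
    fix i assume "i < dim_vec (\<beta> \<cdot>\<^sub>v v)"
    then have i: "i < ?N" by (simp add: v_def)
    have "(map_mat hom A *\<^sub>v v) $ i = (\<Sum>j\<in>{0..<?N}. hom (c (g i) (g j)) * e (g j))"
      using i by (simp add: A_def v_def scalar_prod_def)
    also have "\<dots> = (\<Sum>j\<in>I. hom (c (g i) j) * e j)"
      by (rule sum.reindex_bij_betw[OF g])
    also have "\<dots> = (\<beta> \<cdot>\<^sub>v v) $ i"
      using c gI[OF i] i by (simp add: v_def)
    finally show "(map_mat hom A *\<^sub>v v) $ i = (\<beta> \<cdot>\<^sub>v v) $ i" .
  qed (simp add: A_def v_def)
  moreover have "v \<noteq> 0\<^sub>v ?N"
  proof
    assume v0: "v = 0\<^sub>v ?N"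
    obtain i where i: "i < ?N" "g i = k"
      using g I(2) unfolding bij_betw_def by (metis imageE atLeastLessThan_iff)
    have "v $ i = e k" using i by (simp add: v_def)
    with v0 i I(3) show False by simp
  qed
  ultimately have "eigenvector (map_mat hom A) v \<beta>"
    using A v by (simp add: eigenvector_def)
  then have "eigenvalue (map_mat hom A) \<beta>"
    by (auto simp: eigenvalue_def)
  then have "poly (char_poly (map_mat hom A)) \<beta> = 0"
    using eigenvalue_root_char_poly[of "map_mat hom A" ?N] A by simp
  then have "poly (map_poly hom (char_poly A)) \<beta> = 0"
    by (simp add: char_poly_hom[OF A])
  then show ?thesis
    using degree_monic_char_poly[OF A] by auto
qed

text \<open>Pseudo-division only multiplies the dividend by a power of the leading coefficient of
  \<open>g\<close>, here 1, so it is true division over any commutative ring, in particular over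
  \<int>.\<close>

lemma monic_division:
  fixes g :: "'a :: comm_ring_1 poly"
  assumes "lead_coeff g = 1"
  obtains q r where "f = g * q + r" "r = 0 \<or> degree r < degree g"
proof -
  have "g \<noteq> 0" using assms by auto
  moreover obtain q r where "pseudo_divmod f g = (q, r)" by fastforce
  ultimately show ?thesis
    using pseudo_divmod[of g f q r] assms that by simp
qed

lemma poly_eq_sum_lessThan:
  fixes p :: "'a :: comm_semiring_1 poly"
  assumes "p = 0 \<or> degree p < m"
  shows "poly p x = (\<Sum>i<m. coeff p i * x ^ i)"
proof (cases "p = 0")
  case False
  with assms have "degree p < m" by simp
  then show ?thesis
    unfolding poly_altdef[of p x] by (auto intro!: sum.mono_neutral_left le_degree simp: coeff_eq_0)
qed simp

section \<open>Integer polynomials: Gauss's lemma and denominators\<close>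

text \<open>
  By Gauss's lemma, a primitive integer polynomial of least degree with root \<open>\<beta>\<close> divides every
  monic one in \<open>\<int>[X]\<close>, so its leading coefficient is a unit.
\<close>

lemma monic_int_poly_of_root:
  fixes \<beta> :: "'a :: field_char_0"
  assumes "algebraic_int \<beta>" and "q \<noteq> 0" and "poly (map_poly of_int q) \<beta> = 0"
  obtains p :: "int poly" where "lead_coeff p = 1" "degree p \<le> degree q" "poly (map_poly of_int p) \<beta> = 0"
proof -
  define P where "P = (\<lambda>p :: int poly. p \<noteq> 0 \<and> poly (map_poly of_int p) \<beta> = 0)"
  obtain g where g: "lead_coeff g = 1" "poly (map_poly of_int g) \<beta> = 0"
    using assms(1) by (auto simp: algebraic_int_altdef_ipoly)
  have "P q" using assms by (simp add: P_def)
  then obtain r where r: "P r" and least: "\<And>p. P p \<Longrightarrow> degree r \<le> degree p"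
    using ex_has_least_nat[of P _ degree] by metis
  define s where "s = primitive_part r"
  have r_eq: "r = smult (content r) s" and s0: "s \<noteq> 0" and s1: "content s = 1"
    using r by (auto simp: s_def P_def)
  have "poly (map_poly of_int (smult (content r) s)) \<beta> = 0"
    using r unfolding r_eq[symmetric] P_def by blast
  then have "of_int (content r) * poly (map_poly of_int s) \<beta> = 0"
    by (simp add: hom_distribs)
  moreover have "content r \<noteq> 0" using r by (simp add: P_def)
  ultimately have s: "poly (map_poly of_int s) \<beta> = 0" by simp
  have degs: "degree s = degree r" by (simp add: s_def)
  obtain a k where a: "a \<noteq> 0" "smult a g = s * k + pseudo_mod g s"
    and t: "pseudo_mod g s = 0 \<or> degree (pseudo_mod g s) < degree s"
    using pseudo_mod[OF s0, of g] by blast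
  have "pseudo_mod g s = smult a g - s * k" using a by simp
  then have "poly (map_poly of_int (pseudo_mod g s)) \<beta> = 0"
    using g s by (simp add: hom_distribs)
  \<comment> \<open>A nonzero remainder would have root \<beta> and degree below the minimal degree
    of \<open>r\<close>.\<close>
  then have "pseudo_mod g s = 0"
    using least[of "pseudo_mod g s"] t degs by (fastforce simp: P_def)
  then have ak: "smult a g = s * k" using a by simp
  have "content g dvd lead_coeff g" by (rule content_dvd_coeff)
  then have "content g = 1"
    using g(1) by (metis normalize_content normalize_1_iff is_unit_normalize)
  \<comment> \<open>Contents are multiplicative, and both \<open>g\<close> and \<open>s\<close> have
    content 1. Hence \<open>a\<close> divides \<open>k\<close> and cancels, leaving an honest
    factorisation of \<open>g\<close> in \<int>[X].\<close>
  then have "normalize a = content k"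
    using arg_cong[OF ak, of content] s1 by (simp add: content_mult)
  then have "a dvd content k" by (metis dvd_normalize_iff dvd_refl normalize_dvd_iff)
  then have "[:a:] dvd k"
    by (simp add: const_poly_dvd_iff_dvd_content)
  then obtain k' where "k = smult a k'"
    by (auto elim!: dvdE)
  then have "smult a (g - s * k') = 0"
    using ak by (simp add: smult_diff_right)
  then have "g = s * k'"
    using a(1) by simp
  then have lc: "lead_coeff s * lead_coeff k' = 1"
    using g(1) by (metis lead_coeff_mult)
  \<comment> \<open>The leading coefficient of \<open>s\<close> is a unit with inverse
    \<open>lead_coeff k'\<close>, so this scaling is monic.\<close>
  define p where "p = smult (lead_coeff k') s"
  show thesis
  proof (rule that)
    have "k' \<noteq> 0" using lc by auto
    then show "lead_coeff p = 1" using lc by (simp add: p_def mult.commute)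
    show "degree p \<le> degree q"
      using least[OF \<open>P q\<close>] degs by (auto simp: p_def)
    show "poly (map_poly of_int p) \<beta> = 0" using s by (simp add: p_def hom_distribs)
  qed
qed

lemma clear_denominators:
  obtains d :: int and g :: "int poly" where "d > 0" "smult (of_int d) f = map_poly rat_of_int g"
proof -
  have "\<exists>d>0. \<exists>g. smult (of_int d) f = map_poly rat_of_int g"
  proof (induction f)
    case 0
    show ?case by (intro exI[of _ 1] conjI exI[of _ 0]) auto
  next
    case (pCons c f)
    then obtain d g where d: "d > 0" "smult (of_int d) f = map_poly rat_of_int g" by blast
    obtain a b where ab: "b > 0" "c = of_int a / of_int b"
      by (cases c) (auto simp: Fract_of_int_quotient)
    have "smult (of_int (d * b)) (pCons c f) = pCons (of_int (d * a)) (smult (of_int b) (smult (of_int d) f))"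
      using ab by (simp add: mult.commute)
    also have "\<dots> = map_poly rat_of_int (pCons (d * a) (smult b g))"
      unfolding d by (simp add: map_poly_pCons hom_distribs)
    finally show ?case using d(1) ab(1) by (meson mult_pos_pos)
  qed
  then show ?thesis using that by blast
qed

section \<open>Annihilators of f(\<alpha>) and transitivity of integrality\<close>

lemma comm_ring_hom_of_rat: "comm_ring_hom (of_rat :: rat \<Rightarrow> 'a :: field_char_0)"
  by unfold_locales

lemma comm_ring_hom_of_int: "comm_ring_hom (of_int :: int \<Rightarrow> 'a :: field_char_0)"
  by unfold_locales

lemma eval_rat_of_int: "eval_rat (map_poly of_int p) \<alpha> = poly (map_poly of_int p) \<alpha>"
proof -
  have "map_poly of_rat (map_poly rat_of_int p) = (map_poly of_int p :: qbar poly)"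
    by (rule poly_eqI) (simp add: coeff_map_poly)
  then show ?thesis by (simp add: eval_rat_def)
qed

lemma eval_rat_power_var: "eval_rat (monom 1 i) \<alpha> = \<alpha> ^ i"
  by (simp add: eval_rat_def map_poly_monom poly_monom)

lemma eval_rat_eq_sum:
  assumes "p = 0 \<or> degree p < m"
  shows "eval_rat p \<alpha> = (\<Sum>i<m. of_rat (coeff p i) * \<alpha> ^ i)"
  unfolding eval_rat_def using assms by (subst poly_eq_sum_lessThan[where m = m]) (auto simp: coeff_map_poly)

lemma degree_min_poly_pos: "degree (min_poly \<alpha>) > 0"
proof (rule ccontr)
  assume "\<not> degree (min_poly \<alpha>) > 0"
  then obtain c where c: "min_poly \<alpha> = [:c:]" by (auto elim: degree_eq_zeroE)
  then show False using min_poly[of \<alpha>] by (auto simp: is_min_poly_def)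
qed

text \<open>Multiplication by f(\<alpha>) preserves the rational span of the powers of \<alpha>
  below the degree of \<alpha>. The resulting characteristic polynomial has a degree that does not
  depend on f.\<close>

lemma monic_rat_poly_of_eval_rat:
  obtains p where "degree p = alg_degree \<alpha>" "lead_coeff p = 1" "eval_rat p (eval_rat f \<alpha>) = 0"
proof -
  let ?m = "alg_degree \<alpha>"
  have stable: "\<exists>c. eval_rat f \<alpha> * \<alpha> ^ i = (\<Sum>j\<in>{..<?m}. of_rat (c j) * \<alpha> ^ j)" for i
  proof -
    \<comment> \<open>Within this block \<open>?m\<close> is the minimal polynomial itself, no
      longer its degree.\<close>
    let ?m = "min_poly \<alpha>"
    define q r where "q = f * monom 1 i div ?m" and "r = f * monom 1 i mod ?m"
    have "f * monom 1 i = ?m * q + r"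
      unfolding q_def r_def by simp
    moreover have "eval_rat ?m \<alpha> = 0"
      using min_poly by (simp add: is_min_poly_def)
    ultimately have "eval_rat (f * monom 1 i) \<alpha> = eval_rat r \<alpha>"
      by simp
    moreover have "min_poly \<alpha> \<noteq> 0" using degree_min_poly_pos[of \<alpha>] by auto
    then have "r = 0 \<or> degree r < alg_degree \<alpha>"
      unfolding alg_degree_def r_def by (rule degree_mod_less)
    ultimately show ?thesis
      using eval_rat_eq_sum by (auto simp: eval_rat_power_var)
  qed
  have "\<exists>p. degree p = card {..<?m} \<and> lead_coeff p = 1 \<and> poly (map_poly of_rat p) (eval_rat f \<alpha>) = 0"
    using degree_min_poly_pos[of \<alpha>] stable
    by (intro monic_annihilator[where k = 0 and e = "\<lambda>i. \<alpha> ^ i"] comm_ring_hom_of_rat)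
       (auto simp: alg_degree_def)
  then show ?thesis using that by (auto simp: eval_rat_def)
qed

text \<open>The rational annihilator bounds the degree, and Gauss's lemma gives a monic integer one
  within that bound. The exact degree n makes the polynomials for different \<alpha> comparable
  modulo an integer.\<close>

lemma monic_int_poly_of_eval_rat:
  assumes "algebraic_int (eval_rat f \<alpha>)" and "alg_degree \<alpha> \<le> n"
  obtains p :: "int poly" where "lead_coeff p = 1" "degree p = n" "poly (map_poly of_int p) (eval_rat f \<alpha>) = 0"
proof -
  obtain p where p: "degree p = alg_degree \<alpha>" "lead_coeff p = 1" "eval_rat p (eval_rat f \<alpha>) = 0"
    by (rule monic_rat_poly_of_eval_rat)
  obtain d g where d: "d > 0" "smult (of_int d) p = map_poly rat_of_int g"
    by (rule clear_denominators)
  have "poly (map_poly of_int g) (eval_rat f \<alpha>) = eval_rat (smult (of_int d) p) (eval_rat f \<alpha>)"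
    by (simp add: d eval_rat_of_int)
  then have g0: "poly (map_poly of_int g) (eval_rat f \<alpha>) = 0" using p by simp
  have "smult (of_int d) p \<noteq> 0" using d p by auto
  then have "g \<noteq> 0" using d by auto
  have "degree g = degree (map_poly rat_of_int g)" by (simp add: degree_map_poly)
  also have "\<dots> = alg_degree \<alpha>" using d p by (simp flip: d(2))
  finally have dg: "degree g = alg_degree \<alpha>" .
  obtain q where q: "lead_coeff q = 1" "degree q \<le> degree g" "poly (map_poly of_int q) (eval_rat f \<alpha>) = 0"
    using monic_int_poly_of_root[OF assms(1) \<open>g \<noteq> 0\<close> g0] by blast
  show thesis
  proof (rule that)
    \<comment> \<open>A power of X pads the degree up to n and keeps the root; the subtraction does
      not truncate, as \<open>degree q\<close> is at most
      \<open>alg_degree \<alpha>\<close>.\<close>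
    let ?q = "monom 1 (n - degree q) * q"
    have q0: "q \<noteq> 0" using q by auto
    show "lead_coeff ?q = 1" using q(1) by (simp add: lead_coeff_mult degree_monom_eq)
    show "degree ?q = n"
      using q0 q(2) dg assms(2) by (simp add: degree_mult_eq degree_monom_eq)
    show "poly (map_poly of_int ?q) (eval_rat f \<alpha>) = 0" using q by (simp add: hom_distribs)
  qed
qed


text \<open>The products \<alpha>^i \<beta>^j, with i and j below the degrees of the two monic
  equations, span a family over \<int> that is stable under \<beta>, so
  \<open>monic_annihilator\<close> applies.\<close>

lemma algebraic_int_trans:
  fixes \<alpha> \<beta> :: "'a :: field_char_0"
  assumes \<alpha>: "algebraic_int \<alpha>" and p: "lead_coeff p = 1" "poly p \<beta> = 0"
    and coeffs: "\<And>i. coeff p i \<in> range (\<lambda>q. poly (map_poly of_int q) \<alpha>)"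
  shows "algebraic_int \<beta>"
proof -
  obtain h where h: "lead_coeff h = 1" "poly (map_poly of_int h) \<alpha> = 0"
    using \<alpha> by (auto simp: algebraic_int_altdef_ipoly)
  let ?m = "degree h" and ?k = "degree p"
  \<comment> \<open>Positive degrees put (0, 0) into the index set, where the family takes the
    nonzero value 1.\<close>
  have m: "?m > 0"
  proof (rule ccontr)
    assume "\<not> ?m > 0"
    then obtain c where "h = [:c:]" by (auto elim: degree_eq_zeroE)
    with h show False by simp
  qed
  have k: "?k > 0"
  proof (rule ccontr)
    assume "\<not> ?k > 0"
    then obtain c where "p = [:c:]" by (auto elim: degree_eq_zeroE)
    with p show False by simp
  qed
  have adjoin: "\<exists>c. poly (map_poly of_int q) \<alpha> = (\<Sum>i<?m. of_int (c i) * \<alpha> ^ i)" for q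
  proof -
    obtain u r where r: "q = h * u + r" "r = 0 \<or> degree r < ?m"
      using monic_division[OF h(1)] by metis
    have "poly (map_poly of_int q) \<alpha> = poly (map_poly of_int r) \<alpha>"
      by (simp add: r(1) h(2) hom_distribs)
    also have "\<dots> = (\<Sum>i<?m. of_int (coeff r i) * \<alpha> ^ i)"
      using r(2) by (subst poly_eq_sum_lessThan[where m = ?m]) auto
    finally show ?thesis by blast
  qed
  let ?I = "{..<?m} \<times> {..<?k}" and ?e = "\<lambda>(i, j). \<alpha> ^ i * \<beta> ^ j"
  have "\<exists>c. \<beta> * ?e l = (\<Sum>l'\<in>?I. of_int (c l') * ?e l')" if lI: "l \<in> ?I" for l
  proof -
    obtain i j where l: "l = (i, j)" "i < ?m" "j < ?k" using lI by auto
    show ?thesis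
    proof (cases "Suc j = ?k")
      case False
      \<comment> \<open>Below the top exponent, multiplication by \<beta> merely shifts j to j +
        1.\<close>
      define c :: "nat \<times> nat \<Rightarrow> int" where "c = (\<lambda>l'. if l' = (i, Suc j) then 1 else 0)"
      have "(\<Sum>l'\<in>?I. of_int (c l') * ?e l') = (\<Sum>l'\<in>?I. if l' = (i, Suc j) then ?e l' else 0)"
        by (rule sum.cong) (auto simp: c_def)
      also have "\<dots> = \<beta> * ?e l"
        using l False by (subst sum.delta) auto
      finally show ?thesis by (intro exI[of _ c]) (rule sym)
    next
      case True
      have "\<exists>c. \<alpha> ^ i * coeff p j' = (\<Sum>i'<?m. of_int (c i') * \<alpha> ^ i')" for j'
      proof -
        obtain q where "coeff p j' = poly (map_poly of_int q) \<alpha>" using coeffs[of j'] by blast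
        then have "\<alpha> ^ i * coeff p j' = poly (map_poly of_int (monom 1 i * q)) \<alpha>"
          by (simp add: hom_distribs poly_monom)
        then show ?thesis using adjoin by metis
      qed
      then obtain c where c: "\<And>j'. \<alpha> ^ i * coeff p j' = (\<Sum>i'<?m. of_int (c j' i') * \<alpha> ^ i')"
        by metis
      \<comment> \<open>At the top exponent the monic equation \<open>p\<close> replaces \<beta>^k
        by lower powers; its coefficients lie in \<int>[\<alpha>] and reduce to the powers of
        \<alpha> by \<open>adjoin\<close>.\<close>
      have "(\<Sum>j'<?k. coeff p j' * \<beta> ^ j') + \<beta> ^ ?k = 0"
        using p by (simp add: poly_altdef flip: lessThan_Suc_atMost)
      then have "\<beta> ^ ?k = - (\<Sum>j'<?k. coeff p j' * \<beta> ^ j')"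
        by (simp add: eq_neg_iff_add_eq_0 add.commute)
      moreover have "\<beta> * ?e l = \<alpha> ^ i * \<beta> ^ ?k"
        using l by (simp flip: True)
      ultimately have "\<beta> * ?e l = - (\<Sum>j'<?k. \<alpha> ^ i * coeff p j' * \<beta> ^ j')"
        by (simp add: sum_distrib_left mult.assoc)
      also have "\<dots> = (\<Sum>j'<?k. \<Sum>i'<?m. of_int (- c j' i') * (\<alpha> ^ i' * \<beta> ^ j'))"
        unfolding c by (simp add: sum_distrib_right sum_negf mult.assoc)
      also have "\<dots> = (\<Sum>i'<?m. \<Sum>j'<?k. of_int (- c j' i') * (\<alpha> ^ i' * \<beta> ^ j'))"
        by (rule sum.swap)
      also have "\<dots> = (\<Sum>l'\<in>?I. of_int ((\<lambda>(i', j'). - c j' i') l') * ?e l')"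
        by (simp add: sum.cartesian_product case_prod_unfold)
      finally show ?thesis by (rule exI[of _ "\<lambda>(i', j'). - c j' i'"])
    qed
  qed
  then have "\<exists>q. degree q = card ?I \<and> lead_coeff q = 1 \<and> poly (map_poly of_int q) \<beta> = 0"
    using m k by (intro monic_annihilator[where k = "(0, 0)" and e = ?e] comm_ring_hom_of_int) auto
  then show ?thesis by (auto simp: algebraic_int_altdef_ipoly)
qed

section \<open>The field \<rat>(X): integral closedness, quotient field, first inclusion\<close>

lemma comm_ring_hom_to_fract: "comm_ring_hom (to_fract :: 'a :: idom \<Rightarrow> 'a fract)"
  by unfold_locales auto

lemma comm_ring_hom_eval_rat: "comm_ring_hom (\<lambda>f. eval_rat f \<alpha>)"
  by unfold_locales auto

lemma (in comm_ring_hom) hom_poly_of_int: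
  "hom (poly (map_poly of_int p) x) = poly (map_poly of_int p) (hom x)"
  by (induction p) (simp_all add: map_poly_pCons hom_add hom_mult hom_of_int)

text \<open>The rational root argument: for x = a/b in lowest terms, clearing denominators leaves
  every term except a^n divisible by b. So b divides a^n, and coprimality makes b a unit.\<close>

lemma integral_fract_in_range_to_fract:
  fixes x :: "'a :: {idom_divide, ring_gcd, semiring_gcd_mult_normalize} fract"
  assumes p: "lead_coeff p = 1" "poly p x = 0" and coeffs: "\<And>i. coeff p i \<in> range to_fract"
  shows "x \<in> range to_fract"
proof -
  interpret comm_ring_hom "to_fract :: 'a \<Rightarrow> 'a fract" by (rule comm_ring_hom_to_fract)
  define a b where "a = fst (quot_of_fract x)" and "b = snd (quot_of_fract x)"
  have b0: "b \<noteq> 0" and x: "x = to_fract a / to_fract b"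
    by (simp_all add: a_def b_def flip: Fract_conv_to_fract)
  define r where "r i = fst (quot_of_fract (coeff p i))" for i
  have r: "coeff p i = to_fract (r i)" for i
    using coeffs[of i] by (auto simp: r_def)
  let ?n = "degree p"
  have summand: "to_fract b ^ ?n * (coeff p i * x ^ i) = to_fract (r i * a ^ i * b ^ (?n - i))"
    if "i \<le> ?n" for i
  proof -
    have "to_fract b ^ ?n = to_fract b ^ i * to_fract b ^ (?n - i)"
      using that by (simp flip: power_add)
    then show ?thesis using b0 by (simp add: x r hom_power power_divide)
  qed
  have "0 = to_fract b ^ ?n * poly p x" using p by simp
  also have "\<dots> = (\<Sum>i\<le>?n. to_fract (r i * a ^ i * b ^ (?n - i)))"
    unfolding poly_altdef sum_distrib_left by (rule sum.cong) (simp_all only: atMost_iff summand)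
  also have "\<dots> = to_fract (\<Sum>i\<le>?n. r i * a ^ i * b ^ (?n - i))"
    by (simp only: to_fract_sum)
  finally have "(\<Sum>i\<le>?n. r i * a ^ i * b ^ (?n - i)) = 0"
    by (metis to_fract_eq_0_iff)
  moreover have "r ?n = 1" using p(1) r[of ?n] by (metis to_fract_1 to_fract_eq_iff)
  ultimately have "(\<Sum>i<?n. r i * a ^ i * b ^ (?n - i)) + a ^ ?n = 0"
    by (simp flip: lessThan_Suc_atMost)
  moreover have "b dvd (\<Sum>i<?n. r i * a ^ i * b ^ (?n - i))"
    by (rule dvd_sum) (simp add: dvd_power)
  ultimately have "b dvd a ^ ?n"
    by (metis dvd_0_right dvd_add_right_iff)
  moreover have "coprime a b"
    unfolding a_def b_def by (rule coprime_quot_of_fract)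
  ultimately have "is_unit b"
    by (metis coprime_absorb_right coprime_power_left_iff dvd_refl coprime_common_divisor)
  \<comment> \<open>\<open>quot_of_fract\<close> normalises the denominator, and the only normalised
    unit is 1.\<close>
  then have "b = 1"
    by (metis b_def is_unit_normalize normalize_snd_quot_of_fract)
  then show ?thesis by (simp add: x)
qed

lemma map_poly_of_int_in_R_set: "map_poly rat_of_int p \<in> R_set A"
  by (auto simp: R_set_def R_elem_def int_adjoin_def eval_rat_of_int)

lemma of_int_in_R_set: "of_int c \<in> R_set A"
proof -
  have "of_int c = map_poly rat_of_int [:c:]"
    by (rule poly_eqI) (simp add: of_int_poly coeff_map_poly coeff_pCons split: nat.split)
  then show ?thesis by (metis map_poly_of_int_in_R_set)
qed

text \<open>The set contains \<int>[X], and scaling numerator and denominator by a common integer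
  writes any rational function as a quotient of integer polynomials.\<close>

lemma quotient_field_R_set: "quotient_field (to_fract ` R_set A) = UNIV"
proof -
  have "x \<in> quotient_field (to_fract ` R_set A)" for x
  proof -
    define a b where "a = fst (quot_of_fract x)" and "b = snd (quot_of_fract x)"
    have b0: "b \<noteq> 0" and x: "x = to_fract a / to_fract b"
      by (simp_all add: a_def b_def flip: Fract_conv_to_fract)
    obtain d g where d: "d > 0" "smult (of_int d) a = map_poly rat_of_int g"
      by (rule clear_denominators)
    obtain e h where e: "e > 0" "smult (of_int e) b = map_poly rat_of_int h"
      by (rule clear_denominators)
    have a': "smult (of_int (d * e)) a = map_poly rat_of_int (smult e g)"
      using arg_cong[OF d(2), of "smult (of_int e)"] by (simp add: hom_distribs mult.commute)
    have b': "smult (of_int (d * e)) b = map_poly rat_of_int (smult d h)"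
      using arg_cong[OF e(2), of "smult (of_int d)"] by (simp add: hom_distribs)
    let ?c = "[:rat_of_int (d * e):]"
    have c0: "?c \<noteq> 0" using d(1) e(1) by simp
    then have "x = to_fract (?c * a) / to_fract (?c * b)"
      unfolding x to_fract_mult by (metis mult_divide_mult_cancel_left to_fract_eq_0_iff)
    then have "x = to_fract (smult (of_int (d * e)) a) / to_fract (smult (of_int (d * e)) b)"
      by simp
    moreover have "smult (of_int (d * e)) b \<noteq> 0" using b0 c0 by simp
    ultimately show ?thesis
      unfolding a' b' quotient_field_def
      using map_poly_of_int_in_R_set[of "smult e g" A] map_poly_of_int_in_R_set[of "smult d h" A]
      by (metis (mono_tags, lifting) CollectI imageI to_fract_eq_0_iff)
  qed
  then show ?thesis by blast
qed

lemma integral_closure_R_set_subset: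
  assumes "\<And>\<alpha>. \<alpha> \<in> A \<Longrightarrow> algebraic_int \<alpha>"
  shows "integral_closure (to_fract ` R_set A) K \<subseteq> to_fract ` S_set A"
proof
  fix x assume "x \<in> integral_closure (to_fract ` R_set A) K"
  then obtain p where p: "lead_coeff p = 1" "poly p x = 0" "\<And>i. coeff p i \<in> to_fract ` R_set A"
    by (auto simp: integral_closure_def)
  have "x \<in> range to_fract"
    by (rule integral_fract_in_range_to_fract[OF p(1,2)]) (use p(3) in blast)
  then obtain f where f: "x = to_fract f" by blast
  \<comment> \<open>On the range of \<open>to_fract\<close>, taking the numerator inverts the
    embedding, so \<open>r\<close> is \<open>p\<close> pulled back to coefficients in
    \<rat>[X].\<close>
  define r where "r = map_poly (fst \<circ> quot_of_fract) p"
  have coeff_r: "coeff p i = to_fract (coeff r i) \<and> coeff r i \<in> R_set A" for i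
    using p(3)[of i] by (auto simp: r_def coeff_map_poly)
  have pr: "p = map_poly to_fract r"
    by (rule poly_eqI) (simp add: coeff_map_poly coeff_r)
  have "to_fract (lead_coeff r) = to_fract 1"
    using p(1) unfolding pr by (simp add: degree_map_poly coeff_map_poly)
  then have lr: "lead_coeff r = 1"
    by (simp only: to_fract_eq_iff)
  interpret F: comm_ring_hom "to_fract :: rat poly \<Rightarrow> rat poly fract" by (rule comm_ring_hom_to_fract)
  have "to_fract (poly r f) = 0"
    using p(2) unfolding pr f by simp
  \<comment> \<open>The integral equation now lives in \<rat>[X], where evaluation at \<alpha> is a
    ring homomorphism; it could not be applied to fractions.\<close>
  then have rf: "poly r f = 0" by simp
  have "f \<in> S_elem \<alpha>" if "\<alpha> \<in> A" for \<alpha>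
  proof -
    interpret E: comm_ring_hom "\<lambda>f. eval_rat f \<alpha>" by (rule comm_ring_hom_eval_rat)
    let ?P = "map_poly (\<lambda>f. eval_rat f \<alpha>) r"
    have "degree ?P = degree r" using lr by (intro map_poly_degree_eq) simp
    then have "lead_coeff ?P = 1" using lr by (simp add: coeff_map_poly)
    moreover have "poly ?P (eval_rat f \<alpha>) = 0"
      using rf by simp
    moreover have "coeff ?P i \<in> range (\<lambda>q. poly (map_poly of_int q) \<alpha>)" for i
      using coeff_r[of i] that
      by (auto simp: coeff_map_poly R_set_def R_elem_def int_adjoin_def)
    ultimately have "algebraic_int (eval_rat f \<alpha>)"
      using algebraic_int_trans assms[OF that] by blast
    moreover have "eval_rat f \<alpha> \<in> rat_adjoin \<alpha>"
      unfolding rat_adjoin_def by (rule CollectI, rule exI[of _ f], rule exI[of _ 1]) simp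
    ultimately show ?thesis by (simp add: S_elem_def ring_of_integers_def)
  qed
  then show "x \<in> to_fract ` S_set A" unfolding f S_set_def by blast
qed

section \<open>A uniform monic multiplier and the second inclusion\<close>

text \<open>For i at most n - 1, the factor d^(n-1) splits as d^(n-1-i) d^i, and d^i \<beta>^i is a
  power of d\<beta>, hence in \<int>[\<alpha>].\<close>

lemma scaled_poly_in_int_adjoin:
  fixes t :: "int poly"
  assumes "of_int d * \<beta> \<in> int_adjoin \<alpha>" and "t = 0 \<or> degree t < n"
  shows "of_int (d ^ (n - 1)) * poly (map_poly of_int t) \<beta> \<in> int_adjoin \<alpha>"
proof -
  obtain g where g: "of_int d * \<beta> = poly (map_poly of_int g) \<alpha>"
    using assms(1) by (auto simp: int_adjoin_def)
  let ?s = "\<Sum>i<n. smult (coeff t i * d ^ (n - 1 - i)) (g ^ i)"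
  have "of_int (d ^ (n - 1)) * poly (map_poly of_int t) \<beta>
      = (\<Sum>i<n. of_int (d ^ (n - 1)) * (of_int (coeff t i) * \<beta> ^ i))"
    using assms(2) by (subst poly_eq_sum_lessThan[where m = n]) (auto simp: sum_distrib_left)
  also have "\<dots> = (\<Sum>i<n. of_int (coeff t i * d ^ (n - 1 - i)) * (of_int d * \<beta>) ^ i)"
  proof (rule sum.cong)
    fix i assume "i \<in> {..<n}"
    then have "d ^ (n - 1) = d ^ (n - 1 - i) * d ^ i"
      by (simp flip: power_add)
    then show "of_int (d ^ (n - 1)) * (of_int (coeff t i) * \<beta> ^ i)
        = of_int (coeff t i * d ^ (n - 1 - i)) * (of_int d * \<beta>) ^ i"
      by (simp add: power_mult_distrib)
  qed simp
  also have "\<dots> = poly (map_poly of_int ?s) \<alpha>"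
    unfolding g by (simp add: hom_distribs poly_sum)
  finally show ?thesis by (auto simp: int_adjoin_def)
qed

text \<open>Only the n coefficients below the leading one vary, and each can be reduced modulo D. A
  representative is encoded as the list of these residues, with \<open>monom 1 n\<close> added as
  leading term.\<close>

lemma finite_monic_representatives:
  fixes D :: int
  assumes "D > 0"
  obtains H :: "int poly set" where "finite H" "\<And>h. h \<in> H \<Longrightarrow> lead_coeff h = 1"
    "\<And>m. lead_coeff m = 1 \<Longrightarrow> degree m = n \<Longrightarrow> \<exists>h\<in>H. [:D:] dvd m - h"
proof -
  define L where "L = {l. set l \<subseteq> {0..<D} \<and> length l = n}"
  let ?h = "\<lambda>l. monom 1 n + Poly l"
  have "finite (?h ` L)"
    unfolding L_def by (intro finite_imageI finite_lists_length_eq) simp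
  moreover have "lead_coeff h = 1" if h: "h \<in> ?h ` L" for h
  proof -
    obtain l where l: "l \<in> L" "h = ?h l" using h by blast
    have c: "coeff h n = 1" "\<And>i. i > n \<Longrightarrow> coeff h i = 0"
      using l by (auto simp: L_def nth_default_def)
    then have "degree h = n"
      by (intro antisym degree_le le_degree) auto
    with c show ?thesis by simp
  qed
  moreover have "\<exists>h\<in>?h ` L. [:D:] dvd m - h" if m: "lead_coeff m = 1" "degree m = n" for m
  proof -
    let ?l = "map (\<lambda>i. coeff m i mod D) [0..<n]"
    have "?l \<in> L" using assms by (auto simp: L_def)
    moreover have "D dvd coeff (m - ?h ?l) i" for i
    proof (cases i n rule: linorder_cases)
      case less
      then show ?thesis by (simp add: nth_default_def dvd_minus_mod)
    next
      case equal
      then show ?thesis using m by (simp add: nth_default_def)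
    next
      case greater
      then show ?thesis using m by (simp add: nth_default_def coeff_eq_0)
    qed
    then have "[:D:] dvd m - ?h ?l" by (simp only: const_poly_dvd_iff) blast
    ultimately show ?thesis by blast
  qed
  ultimately show ?thesis by (rule that)
qed

text \<open>The point is uniformity: \<open>P\<close> is chosen from f and n before \<alpha>, so
  that one polynomial serves every \<alpha> of degree at most n.\<close>

lemma monic_multiplier:
  obtains P :: "int poly" where "lead_coeff P = 1"
    "\<And>\<alpha>. algebraic_int (eval_rat f \<alpha>) \<Longrightarrow> alg_degree \<alpha> \<le> n \<Longrightarrow>
      - (eval_rat f \<alpha> * poly (map_poly of_int P) (eval_rat f \<alpha>)) \<in> int_adjoin \<alpha>"
proof -
  obtain d g where d: "d > 0" "smult (of_int d) f = map_poly rat_of_int g"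
    by (rule clear_denominators)
  \<comment> \<open>This is the power that \<open>scaled_poly_in_int_adjoin\<close> needs for
    polynomials of degree below n.\<close>
  define D where "D = d ^ (n - 1)"
  have "D > 0" using d(1) by (simp add: D_def)
  then obtain H :: "int poly set" where H: "finite H" "\<And>h. h \<in> H \<Longrightarrow> lead_coeff h = 1"
    "\<And>m. lead_coeff m = 1 \<Longrightarrow> degree m = n \<Longrightarrow> \<exists>h\<in>H. [:D:] dvd m - h"
    using finite_monic_representatives by metis
  show thesis
  proof (rule that)
    show "lead_coeff (\<Prod>H) = 1" using H(2) by (simp add: lead_coeff_prod)
    fix \<alpha> assume "algebraic_int (eval_rat f \<alpha>)" "alg_degree \<alpha> \<le> n"
    let ?\<beta> = "eval_rat f \<alpha>"
    obtain m :: "int poly" where m: "lead_coeff m = 1" "degree m = n" "poly (map_poly of_int m) ?\<beta> = 0"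
      using monic_int_poly_of_eval_rat \<open>algebraic_int ?\<beta>\<close> \<open>alg_degree \<alpha> \<le> n\<close> by blast
    obtain h r where h: "h \<in> H" "m - h = [:D:] * r"
      using H(3)[OF m(1,2)] by (auto elim: dvdE)
    define k where "k = \<Prod>(H - {h})"
    have Hk: "\<Prod>H = h * k"
      using H(1) h(1) unfolding k_def by (rule prod.remove)
    \<comment> \<open>\<open>[:0, 1:]\<close> is X and supplies the extra factor \<beta>. Division
      by m does not change the value at \<beta> and brings the degree below n.\<close>
    obtain q t where t: "[:0, 1:] * r * k = m * q + t" "t = 0 \<or> degree t < n"
      using monic_division[OF m(1)] m(2) by metis
    have mh: "h = m - smult D r" using h(2) by (simp add: algebra_simps)
    \<comment> \<open>Since m vanishes at \<beta>, the factor h takes the value -D r(\<beta>); the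
      outer minus sign cancels this one.\<close>
    have "- (?\<beta> * poly (map_poly of_int (\<Prod>H)) ?\<beta>)
        = of_int D * poly (map_poly of_int ([:0, 1:] * r * k)) ?\<beta>"
      unfolding Hk mh by (simp add: hom_distribs m(3) map_poly_pCons)
    also have "\<dots> = of_int D * poly (map_poly of_int t) ?\<beta>"
      unfolding t(1) by (simp add: hom_distribs m(3))
    also have "\<dots> \<in> int_adjoin \<alpha>"
      unfolding D_def
    proof (rule scaled_poly_in_int_adjoin[OF _ t(2)])
      have "of_int d * ?\<beta> = eval_rat (smult (of_int d) f) \<alpha>" by simp
      then show "of_int d * ?\<beta> \<in> int_adjoin \<alpha>"
        unfolding d(2) by (auto simp: int_adjoin_def eval_rat_of_int)
    qed
    finally show "- (?\<beta> * poly (map_poly of_int (\<Prod>H)) ?\<beta>) \<in> int_adjoin \<alpha>" .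
  qed
qed

lemma S_set_subset_integral_closure:
  assumes "A \<subseteq> alg_ints_upto n"
  shows "to_fract ` S_set A \<subseteq> integral_closure (to_fract ` R_set A) UNIV"
proof clarify
  fix f assume f: "f \<in> S_set A"
  obtain P :: "int poly" where P: "lead_coeff P = 1"
    "\<And>\<alpha>. algebraic_int (eval_rat f \<alpha>) \<Longrightarrow> alg_degree \<alpha> \<le> n \<Longrightarrow>
      - (eval_rat f \<alpha> * poly (map_poly of_int P) (eval_rat f \<alpha>)) \<in> int_adjoin \<alpha>"
    using monic_multiplier by blast
  define w where "w = - (f * poly (map_poly of_int P) f)"
  interpret F: comm_ring_hom "to_fract :: rat poly \<Rightarrow> rat poly fract" by (rule comm_ring_hom_to_fract)
  have "w \<in> R_elem \<alpha>" if "\<alpha> \<in> A" for \<alpha>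
  proof -
    interpret E: comm_ring_hom "\<lambda>f. eval_rat f \<alpha>" by (rule comm_ring_hom_eval_rat)
    have "eval_rat w \<alpha> = - (eval_rat f \<alpha> * poly (map_poly of_int P) (eval_rat f \<alpha>))"
      by (simp add: w_def E.hom_uminus E.hom_poly_of_int)
    moreover have "algebraic_int (eval_rat f \<alpha>)" "alg_degree \<alpha> \<le> n"
      using f that assms by (auto simp: S_set_def S_elem_def ring_of_integers_def alg_ints_upto_def)
    ultimately show ?thesis using P(2) by (simp add: R_elem_def)
  qed
  then have w: "w \<in> R_set A" by (simp add: R_set_def)
  \<comment> \<open>This is Y P(Y) + w: its constant term is w, and all other coefficients are
    integers.\<close>
  let ?Q = "pCons (to_fract w) (map_poly of_int P)"
  have "P \<noteq> 0" using P(1) by auto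
  then have "lead_coeff ?Q = 1"
    using P(1) by (simp add: degree_map_poly coeff_map_poly map_poly_eq_0_iff)
  moreover have "poly ?Q (to_fract f) = 0"
    by (simp add: w_def F.hom_uminus F.hom_poly_of_int)
  moreover have "coeff ?Q i \<in> to_fract ` R_set A" for i
  proof (cases i)
    case (Suc j)
    have "coeff ?Q i = to_fract (of_int (coeff P j))"
      by (simp add: Suc coeff_map_poly F.hom_of_int)
    then show ?thesis using of_int_in_R_set by blast
  qed (use w in simp)
  ultimately show "to_fract f \<in> integral_closure (to_fract ` R_set A) UNIV"
    unfolding integral_closure_def by blast
qed

theorem theorem3p1:
  fixes n :: nat and A :: "qbar set"
  assumes "n > 0" and "A \<subseteq> alg_ints_upto n"
  shows "quotient_field (to_fract ` R_set A) = UNIV \<and>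
         integral_closure (to_fract ` R_set A) (quotient_field (to_fract ` R_set A))
           = to_fract ` S_set A"
proof -
  have "algebraic_int \<alpha>" if "\<alpha> \<in> A" for \<alpha>
    using assms(2) that by (auto simp: alg_ints_upto_def)
  then show ?thesis
    unfolding quotient_field_R_set
    using integral_closure_R_set_subset[of A UNIV] S_set_subset_integral_closure[OF assms(2)]
    by blast
qed

end
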